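(* Under the multivariate Cole–Hopf transformation $$J^i_t(x)=-\sum_{j=1}^N\alpha_{ij}\log Z^j_t(x),\qquad\text{equivalently}\qquad Z^i_t(x)=\exp\Big(-\sum_{j=1}^N\beta_{ij}J^j_t(x)\Big),\qquad i=1,\dots,N,$$ the system of coupled nonlinear Hamilton–Jacobi–Bellman equations, for $i=1,\dots,N$, $$\begin{aligned}-\partial_tJ^i={}&C^i_t(x)+(f(x)+g(x)\bar u^i)^\top\nabla_xJ^i+\frac12\mathrm{Tr}\big(g(x)g(x)^\top\nabla^2_{xx}J^i\big)\\&-\frac12\nabla\boldsymbol J^\top\big(\beta^\top\otimes g(x)\big)\,\mathrm{diag}_{1\le j\le N}(\alpha_{ij}I_m)\,\big(\beta\otimes g(x)^\top\big)\nabla\boldsymbol J,\end{aligned}$$ with terminal conditions $J^i_T(x)=\Psi_i(x)$, where $\nabla\boldsymbol J:=[(\nabla_xJ^1)^\top,\dots,(\nabla_xJ^N)^\top]^\top\in\mathbb R^{Nn}$, is equivalent to the following system of decoupled linear PDEs for each $i\in\{1,\dots,N\}$: $$-\partial_tZ^i_t=(f(x)+g(x)\bar u^i)^\top\nabla_xZ^i_t+\frac12\mathrm{Tr}\big(g(x)g(x)^\top\nabla^2_{xx}Z^i_t\big)-\Big(\sum_{j=1}^N\beta_{ij}C^j_t(x)\Big)Z^i_t,$$ $$Z^i_T(x)=\exp\Big(-\sum_{j=1}^N\beta_{ij}\Psi_j(x)\Big).$$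
   Context: $[0,T]$ is a finite horizon; $f:\mathbb R^n\to\mathbb R^n$ and $g:\mathbb R^n\to\mathbb R^{n\times m}$ are sufficiently regular to ensure existence of a unique strong solution of the state equation $dx_t=f(x_t)\,dt+g(x_t)\,dv_t$. For each player $i\in\{1,\dots,N\}$, $C^i_t:\mathbb R^n\to\mathbb R$ is a running cost, $\Psi_i:\mathbb R^n\to\mathbb R$ a terminal cost, and $\bar u^i\in\mathbb R^m$ (i.e. $\bar u^i_t$) a given nominal feedback policy. The matrix $\alpha=(\alpha_{ij})\in\mathbb R^{N\times N}$ is nonsingular with $\alpha_{ii}>0$ (not necessarily symmetric), and $\beta=(\beta_{ij}):=\alpha^{-1}$. $\otimes$ is the Kronecker product; $\mathrm{diag}_{1\le j\le N}(\alpha_{ij}I_m)$ is the $Nm\times Nm$ block-diagonal matrix with blocks $\alpha_{i1}I_m,\dots,\alpha_{iN}I_m$. $J^i_t(x)=J^i(t,x)$ is the value function of player $i$ and $Z^i_t(x)$ is its transformed desirability function. The HJB system is the one stated to govern the feedback Nash equilibrium of the $N$-player game in which player $i$ chooses the feedback control $u^i$ in $dx_t=f(x_t)\,dt+g(x_t)(u^i_t\,dt+dw^i_t)$ ($w^i$ a standard $m$-dimensional Wiener process) to minimize $\mathbb E\big[\int_0^T\big(C^i_t(x_t)+\sum_{j=1}^N\frac{\alpha_{ij}}2(u^j_t-\bar u^j_t)^\top(2u^i_t-u^j_t-\bar u^j_t)\big)dt+\Psi_i(x_T)\big]$.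
   Formalization: The claim fails for differing nominal policies; the formal theorem adds the hypothesis that g(x)ū^i = g(x)ū^j whenever α_ij ≠ 0 (e.g. one common nominal policy, or diagonal α). *)

theory Defs
  imports "HOL-Analysis.Analysis"
begin

text \<open>
  The players are the elements of a finite index type \<open>'p\<close>; the state and the control space are
  \<open>real^'n\<close> and \<open>real^'m\<close>.  Functions of time and state are curried, and only their values at
  times in \<open>{0..T}\<close> are relevant.
\<close>

definition gradient :: "(real^'n \<Rightarrow> real) \<Rightarrow> real^'n \<Rightarrow> real^'n"
  where "gradient u x = (\<chi> k. frechet_derivative u (at x) (axis k 1))"

definition hessian :: "(real^'n \<Rightarrow> real) \<Rightarrow> real^'n \<Rightarrow> real^'n^'n"
  where "hessian u x = jacobian (gradient u) (at x)"

text \<open>The time derivative is taken relative to \<open>{0..T}\<close>, i.e. it is one-sided at time 0.\<close>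

definition time_deriv :: "real \<Rightarrow> (real \<Rightarrow> real^'n \<Rightarrow> real) \<Rightarrow> real \<Rightarrow> real^'n \<Rightarrow> real"
  where "time_deriv T u t x = vector_derivative (\<lambda>s. u s x) (at t within {0..T})"

text \<open>
  Regularity of classical solutions: once continuously differentiable in time and twice in space
  on \<open>[0,T) \<times> \<real>\<^sup>n\<close>, and continuous up to the terminal time.  The differentiability clauses are
  needed because the derivative operators above are total.
\<close>

definition C12 :: "real \<Rightarrow> (real \<Rightarrow> real^'n \<Rightarrow> real) \<Rightarrow> bool"
  where "C12 T u \<longleftrightarrow>
    continuous_on ({0..T} \<times> UNIV) (\<lambda>(t, x). u t x) \<and>
    (\<forall>t\<in>{0..<T}. \<forall>x.
       (\<lambda>s. u s x) differentiable (at t within {0..T}) \<and>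
       u t differentiable (at x) \<and>
       gradient (u t) differentiable (at x)) \<and>
    continuous_on ({0..<T} \<times> UNIV) (\<lambda>(t, x). time_deriv T u t x) \<and>
    continuous_on ({0..<T} \<times> UNIV) (\<lambda>(t, x). gradient (u t) x) \<and>
    continuous_on ({0..<T} \<times> UNIV) (\<lambda>(t, x). hessian (u t) x)"

text \<open>
  Block vectors and matrices are indexed by pairs (block, position within the block).
\<close>

definition kronecker :: "real^'b^'a \<Rightarrow> real^'d^'c \<Rightarrow> real^('b \<times> 'd)^('a \<times> 'c)"  (infixl \<open>\<otimes>\<^sub>K\<close> 75)
  where "A \<otimes>\<^sub>K B = (\<chi> r c. A $ fst r $ fst c * B $ snd r $ snd c)"

definition block_diag :: "('p::finite \<Rightarrow> real^'m^'m) \<Rightarrow> real^('p \<times> 'm)^('p \<times> 'm)"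
  where "block_diag D = (\<chi> r c. if fst r = fst c then D (fst r) $ snd r $ snd c else 0)"

definition stacked_gradient ::
    "('p::finite \<Rightarrow> real \<Rightarrow> real^'n \<Rightarrow> real) \<Rightarrow> real \<Rightarrow> real^'n \<Rightarrow> real^('p \<times> 'n)"
  where "stacked_gradient J t x = (\<chi> r. gradient (J (fst r) t) x $ snd r)"

definition hjb_solution ::
    "real \<Rightarrow> (real^'n \<Rightarrow> real^'n) \<Rightarrow> (real^'n \<Rightarrow> real^'m^'n) \<Rightarrow>
     ('p::finite \<Rightarrow> real \<Rightarrow> real^'n \<Rightarrow> real^'m) \<Rightarrow> ('p \<Rightarrow> real \<Rightarrow> real^'n \<Rightarrow> real) \<Rightarrow>
     ('p \<Rightarrow> real^'n \<Rightarrow> real) \<Rightarrow> real^'p^'p \<Rightarrow> ('p \<Rightarrow> real \<Rightarrow> real^'n \<Rightarrow> real) \<Rightarrow> bool"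
  where "hjb_solution T f g ubar C \<Psi> \<alpha> J \<longleftrightarrow>
    (\<forall>i. C12 T (J i) \<and>
      (\<forall>t\<in>{0..<T}. \<forall>x.
        - time_deriv T (J i) t x =
            C i t x
          + (f x + g x *v ubar i t x) \<bullet> gradient (J i t) x
          + 1/2 * trace (g x ** transpose (g x) ** hessian (J i t) x)
          - 1/2 * (stacked_gradient J t x \<bullet>
              (((transpose (matrix_inv \<alpha>) \<otimes>\<^sub>K g x)
                ** block_diag (\<lambda>j. \<alpha> $ i $ j *\<^sub>R mat 1)
                ** (matrix_inv \<alpha> \<otimes>\<^sub>K transpose (g x))) *v stacked_gradient J t x))) \<and>
      (\<forall>x. J i T x = \<Psi> i x))"

text \<open>
  Under the transformation below, the drift of the \<open>i\<close>-th HJB equation contributes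
  \<open>g x *v ubar i t x\<close> to every summand \<open>\<alpha> $ i $ j * ln (Z j t x)\<close>, whereas the linear equation for
  \<open>Z j\<close> carries \<open>g x *v ubar j t x\<close>.  The two systems therefore match only if these vectors agree
  whenever \<open>\<alpha> $ i $ j \<noteq> 0\<close>.
\<close>

definition linear_solution ::
    "real \<Rightarrow> (real^'n \<Rightarrow> real^'n) \<Rightarrow> (real^'n \<Rightarrow> real^'m^'n) \<Rightarrow>
     ('p::finite \<Rightarrow> real \<Rightarrow> real^'n \<Rightarrow> real^'m) \<Rightarrow> ('p \<Rightarrow> real \<Rightarrow> real^'n \<Rightarrow> real) \<Rightarrow>
     ('p \<Rightarrow> real^'n \<Rightarrow> real) \<Rightarrow> real^'p^'p \<Rightarrow> ('p \<Rightarrow> real \<Rightarrow> real^'n \<Rightarrow> real) \<Rightarrow> bool"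
  where "linear_solution T f g ubar C \<Psi> \<alpha> Z \<longleftrightarrow>
    (\<forall>i. C12 T (Z i) \<and>
      (\<forall>t\<in>{0..<T}. \<forall>x.
        - time_deriv T (Z i) t x =
            (f x + g x *v ubar i t x) \<bullet> gradient (Z i t) x
          + 1/2 * trace (g x ** transpose (g x) ** hessian (Z i t) x)
          - (\<Sum>j\<in>UNIV. matrix_inv \<alpha> $ i $ j * C j t x) * Z i t x) \<and>
      (\<forall>x. Z i T x = exp (- (\<Sum>j\<in>UNIV. matrix_inv \<alpha> $ i $ j * \<Psi> j x))))"

text \<open>
  Positivity of \<open>Z\<close> is part of the logarithmic form, since \<open>ln\<close> is total on the reals.
\<close>

definition cole_hopf ::
    "real \<Rightarrow> real^'p^'p \<Rightarrow> ('p \<Rightarrow> real \<Rightarrow> real^'n \<Rightarrow> real) \<Rightarrow> ('p \<Rightarrow> real \<Rightarrow> real^'n \<Rightarrow> real) \<Rightarrow> bool"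
  where "cole_hopf T \<alpha> J Z \<longleftrightarrow>
    (\<forall>i. \<forall>t\<in>{0..T}. \<forall>x. Z i t x > 0 \<and> J i t x = - (\<Sum>j\<in>UNIV. \<alpha> $ i $ j * ln (Z j t x)))"

definition cole_hopf_exp ::
    "real \<Rightarrow> real^'p^'p \<Rightarrow> ('p \<Rightarrow> real \<Rightarrow> real^'n \<Rightarrow> real) \<Rightarrow> ('p \<Rightarrow> real \<Rightarrow> real^'n \<Rightarrow> real) \<Rightarrow> bool"
  where "cole_hopf_exp T \<alpha> J Z \<longleftrightarrow>
    (\<forall>i. \<forall>t\<in>{0..T}. \<forall>x. Z i t x = exp (- (\<Sum>j\<in>UNIV. matrix_inv \<alpha> $ i $ j * J j t x)))"

end

theory Submission
  imports Defs
begin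

text \<open>
  The proof works with the logarithms \<open>L j = ln (Z j)\<close>, so that \<open>Z j = exp (L j)\<close> and
  \<open>J i = - (\<Sum>j. \<alpha> $ i $ j * L j)\<close>.  Put
  \<open>E j = \<partial>\<^sub>t (L j) + (f + g ubar j) \<bullet> \<nabla>(L j) + 1/2 * Tr (g g\<^sup>T \<nabla>\<^sup>2 (L j)) + 1/2 * \<bar>g\<^sup>T \<nabla>(L j)\<bar>\<^sup>2\<close>.
  Dividing the \<open>j\<close>-th linear equation by \<open>Z j\<close> turns it into \<open>E = \<alpha>\<inverse> C\<close>, because the Hessian of
  \<open>exp (L j)\<close> produces the quadratic term.  The quadratic term of the \<open>i\<close>-th HJB equation is
  \<open>\<Sum>j. \<alpha> $ i $ j * \<bar>g\<^sup>T \<nabla>(L j)\<bar>\<^sup>2\<close>, because \<open>\<alpha>\<inverse>\<close> maps the gradients of \<open>J\<close> to those of \<open>- L\<close>, and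
  so the HJB system reads \<open>\<alpha> E = C\<close>.
\<close>

section \<open>Regularity and derivatives\<close>

lemma gradient_eqI:
  assumes "(u has_derivative (\<lambda>h. p \<bullet> h)) (at x)"
  shows "gradient u x = p"
proof -
  have "frechet_derivative u (at x) = (\<lambda>h. p \<bullet> h)"
    using assms by (metis frechet_derivative_at)
  then show ?thesis
    by (simp add: gradient_def vec_eq_iff inner_axis)
qed

lemma has_derivative_gradient:
  assumes "u differentiable (at x)"
  shows "(u has_derivative (\<lambda>h. gradient u x \<bullet> h)) (at x)"
proof -
  let ?D = "frechet_derivative u (at x)"
  have D: "(u has_derivative ?D) (at x)"
    using assms by (simp add: frechet_derivative_works)
  then have lin: "linear ?D"
    by (rule has_derivative_linear)
  have "?D h = gradient u x \<bullet> h" for h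
  proof -
    have "?D h = ?D (\<Sum>k\<in>UNIV. h $ k *\<^sub>R axis k 1)"
      by (simp add: basis_expansion scalar_mult_eq_scaleR[symmetric])
    also have "\<dots> = (\<Sum>k\<in>UNIV. h $ k * ?D (axis k 1))"
      using lin by (simp add: linear_sum linear_cmul)
    finally show ?thesis
      by (simp add: gradient_def inner_vec_def mult.commute)
  qed
  then have "?D = (\<lambda>h. gradient u x \<bullet> h)" by blast
  with D show ?thesis by simp
qed

lemma hessian_eqI:
  assumes "(gradient u has_derivative (\<lambda>h. H *v h)) (at x)"
  shows "hessian u x = H"
proof -
  have "frechet_derivative (gradient u) (at x) = (\<lambda>h. H *v h)"
    using assms by (metis frechet_derivative_at)
  then show ?thesis
    by (simp add: hessian_def jacobian_def)
qed

lemma has_derivative_hessian: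
  assumes "gradient u differentiable (at x)"
  shows "(gradient u has_derivative (\<lambda>h. hessian u x *v h)) (at x)"
  using assms unfolding hessian_def by (simp add: jacobian_works)

text \<open>The derivative within \<open>{0..T}\<close> is unique because \<open>T > 0\<close> makes
  the interval nondegenerate, even at the endpoint 0.\<close>

lemma time_deriv_eqI:
  assumes "T > 0" "t \<in> {0..<T}"
    and "((\<lambda>s. u s x) has_real_derivative a) (at t within {0..T})"
  shows "time_deriv T u t x = a"
  unfolding time_deriv_def
  using assms by (intro vector_derivative_within_closed_interval)
    (auto simp: has_real_derivative_iff_has_vector_derivative)

text \<open>The operators \<open>time_deriv\<close>, \<open>gradient\<close> and
  \<open>hessian\<close> are total, so they are pinned down by exhibiting actual derivatives
  \<open>a\<close>, \<open>p\<close>, \<open>H\<close>. Regularity and the three formulas come out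
  together, so that one computation serves both the solution classes and the equations.\<close>

lemma C12_I:
  fixes u :: "real \<Rightarrow> real^'n \<Rightarrow> real"
  assumes "T > 0"
    and cont: "continuous_on ({0..T} \<times> UNIV) (\<lambda>(t, x). u t x)"
    and a: "\<And>t x. t \<in> {0..<T} \<Longrightarrow> ((\<lambda>s. u s x) has_real_derivative a t x) (at t within {0..T})"
    and p: "\<And>t x. t \<in> {0..<T} \<Longrightarrow> (u t has_derivative (\<lambda>h. p t x \<bullet> h)) (at x)"
    and H: "\<And>t x. t \<in> {0..<T} \<Longrightarrow> (p t has_derivative (\<lambda>h. H t x *v h)) (at x)"
    and ca: "continuous_on ({0..<T} \<times> UNIV) (\<lambda>(t, x). a t x)"
    and cp: "continuous_on ({0..<T} \<times> UNIV) (\<lambda>(t, x). p t x)"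
    and cH: "continuous_on ({0..<T} \<times> UNIV) (\<lambda>(t, x). H t x)"
  shows "C12 T u"
    and "\<And>t x. t \<in> {0..<T} \<Longrightarrow> time_deriv T u t x = a t x"
    and "\<And>t x. t \<in> {0..<T} \<Longrightarrow> gradient (u t) x = p t x"
    and "\<And>t x. t \<in> {0..<T} \<Longrightarrow> hessian (u t) x = H t x"
proof -
  show td: "\<And>t x. t \<in> {0..<T} \<Longrightarrow> time_deriv T u t x = a t x"
    using a \<open>T > 0\<close> by (intro time_deriv_eqI)
  show gr: "\<And>t x. t \<in> {0..<T} \<Longrightarrow> gradient (u t) x = p t x"
    using p by (intro gradient_eqI)
  \<comment> \<open>The Hessian differentiates the whole map \<open>gradient (u t)\<close>, so an
    identity of functions of the state is required, beyond the value at one point.\<close>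
  have gr': "gradient (u t) = p t" if "t \<in> {0..<T}" for t
    using gr that by blast
  show he: "\<And>t x. t \<in> {0..<T} \<Longrightarrow> hessian (u t) x = H t x"
    using H by (intro hessian_eqI) (simp add: gr')
  have "continuous_on ({0..<T} \<times> UNIV) (\<lambda>(t, x). time_deriv T u t x)"
    using ca by (rule continuous_on_cong[THEN iffD1, rotated -1]) (auto simp: td)
  moreover have "continuous_on ({0..<T} \<times> UNIV) (\<lambda>(t, x). gradient (u t) x)"
    using cp by (rule continuous_on_cong[THEN iffD1, rotated -1]) (auto simp: gr)
  moreover have "continuous_on ({0..<T} \<times> UNIV) (\<lambda>(t, x). hessian (u t) x)"
    using cH by (rule continuous_on_cong[THEN iffD1, rotated -1]) (auto simp: he)
  moreover have "(\<lambda>s. u s x) differentiable (at t within {0..T})" if "t \<in> {0..<T}" for t x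
    using a[OF that] by (meson differentiableI has_field_derivative_imp_has_derivative)
  moreover have "u t differentiable (at x)" if "t \<in> {0..<T}" for t x
    using p[OF that] by (rule differentiableI)
  moreover have "gradient (u t) differentiable (at x)" if "t \<in> {0..<T}" for t x
    unfolding gr'[OF that] using H[OF that] by (rule differentiableI)
  ultimately show "C12 T u"
    unfolding C12_def using cont by blast
qed

lemma C12_D:
  assumes "C12 T u"
  shows "continuous_on ({0..T} \<times> UNIV) (\<lambda>(t, x). u t x)"
    and "\<And>t x. t \<in> {0..<T} \<Longrightarrow>
      ((\<lambda>s. u s x) has_real_derivative time_deriv T u t x) (at t within {0..T})"
    and "\<And>t x. t \<in> {0..<T} \<Longrightarrow> (u t has_derivative (\<lambda>h. gradient (u t) x \<bullet> h)) (at x)"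
    and "\<And>t x. t \<in> {0..<T} \<Longrightarrow>
      (gradient (u t) has_derivative (\<lambda>h. hessian (u t) x *v h)) (at x)"
    and "continuous_on ({0..<T} \<times> UNIV) (\<lambda>(t, x). time_deriv T u t x)"
    and "continuous_on ({0..<T} \<times> UNIV) (\<lambda>(t, x). gradient (u t) x)"
    and "continuous_on ({0..<T} \<times> UNIV) (\<lambda>(t, x). hessian (u t) x)"
  using assms unfolding C12_def time_deriv_def
  by (auto simp: has_real_derivative_iff_has_vector_derivative vector_derivative_works[symmetric]
      intro: has_derivative_gradient has_derivative_hessian)

section \<open>Functions that agree at the times in \<open>{0..T}\<close>\<close>

lemma gradient_cong:
  assumes "\<And>t x. t \<in> {0..T} \<Longrightarrow> u t x = v t x" "t \<in> {0..T}"
  shows "gradient (u t) = gradient (v t)" and "hessian (u t) = hessian (v t)"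
proof -
  have "u t = v t" using assms by blast
  then show "gradient (u t) = gradient (v t)" and "hessian (u t) = hessian (v t)" by simp_all
qed

lemma time_deriv_cong:
  assumes "\<And>t x. t \<in> {0..T} \<Longrightarrow> u t x = v t x" "t \<in> {0..T}"
  shows "time_deriv T u t x = time_deriv T v t x"
  unfolding time_deriv_def
  using assms by (intro vector_derivative_cong_eq) (auto simp: eventually_at_filter)

text \<open>The transformation ties \<open>J\<close> and \<open>Z\<close> to the logarithms only at
  times in \<open>{0..T}\<close>. Regularity still transfers, since time derivatives are taken
  within that interval and space derivatives at a fixed time in it.\<close>

lemma C12_cong:
  assumes "T > 0" and eq: "\<And>t x. t \<in> {0..T} \<Longrightarrow> u t x = v t x" and v: "C12 T v"
  shows "C12 T u"
proof (rule C12_I(1)[OF \<open>T > 0\<close>])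
  note D = C12_D[OF v]
  show "continuous_on ({0..T} \<times> UNIV) (\<lambda>(t, x). u t x)"
    using D(1) by (rule continuous_on_cong[THEN iffD1, rotated -1]) (auto simp: eq)
  show "((\<lambda>s. u s x) has_real_derivative time_deriv T v t x) (at t within {0..T})"
    if "t \<in> {0..<T}" for t x
    \<comment> \<open>Agreement holds on all of \<open>{0..T}\<close>, so any positive radius would
      do in place of 1.\<close>
    by (rule has_field_derivative_transform_within[OF D(2)[OF that] zero_less_one])
      (use that eq in auto)
  show "(u t has_derivative (\<lambda>h. gradient (v t) x \<bullet> h)) (at x)" if "t \<in> {0..<T}" for t x
  proof -
    have "u t = v t" using that eq by auto
    then show ?thesis using D(3)[OF that] by simp
  qed
qed (use C12_D[OF v] in auto)

section \<open>Chain rule and linear combinations within \<open>C12\<close>\<close>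

lemma outer_mult_vec:
  fixes p q h :: "real^'n"
  shows "(\<chi> i j. p $ i * q $ j) *v h = (q \<bullet> h) *\<^sub>R p"
  by (simp add: vec_eq_iff matrix_vector_mult_def inner_vec_def sum_distrib_left ac_simps)

text \<open>Serves both directions of the logarithmic transformation: \<open>exp\<close> on all
  reals and \<open>ln\<close> on the positive ones, hence the set \<open>S\<close>. The rank-one
  summand of the Hessian is the source of the quadratic term of the HJB equations.\<close>

lemma C12_compose:
  fixes u :: "real \<Rightarrow> real^'n \<Rightarrow> real"
  assumes "T > 0" and u: "C12 T u"
    and S: "\<And>t x. t \<in> {0..T} \<Longrightarrow> u t x \<in> S"
    and d1: "\<And>y. y \<in> S \<Longrightarrow> (\<phi> has_real_derivative \<phi>' y) (at y)"
    and d2: "\<And>y. y \<in> S \<Longrightarrow> (\<phi>' has_real_derivative \<phi>'' y) (at y)"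
    and c2: "continuous_on S \<phi>''"
  shows "C12 T (\<lambda>t x. \<phi> (u t x))"
    and "\<And>t x. t \<in> {0..<T} \<Longrightarrow>
      time_deriv T (\<lambda>t x. \<phi> (u t x)) t x = \<phi>' (u t x) * time_deriv T u t x"
    and "\<And>t x. t \<in> {0..<T} \<Longrightarrow>
      gradient (\<lambda>x. \<phi> (u t x)) x = \<phi>' (u t x) *\<^sub>R gradient (u t) x"
    and "\<And>t x. t \<in> {0..<T} \<Longrightarrow>
      hessian (\<lambda>x. \<phi> (u t x)) x = \<phi>' (u t x) *\<^sub>R hessian (u t) x
        + \<phi>'' (u t x) *\<^sub>R (\<chi> i j. gradient (u t) x $ i * gradient (u t) x $ j)"
proof -
  note D = C12_D[OF u]
  have c0: "continuous_on S \<phi>"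
    using d1 by (rule DERIV_continuous_on[OF has_field_derivative_at_within])
  have c1: "continuous_on S \<phi>'"
    using d2 by (rule DERIV_continuous_on[OF has_field_derivative_at_within])
  have D1': "continuous_on ({0..<T} \<times> UNIV) (\<lambda>(t, x). u t x)"
    using D(1) by (rule continuous_on_subset) auto
  have comp: "continuous_on ({0..<T} \<times> UNIV) (\<lambda>(t, x). \<psi> (u t x))"
    if "continuous_on S \<psi>" for \<psi> :: "real \<Rightarrow> real"
  proof -
    have "(\<lambda>(t, x). u t x) ` ({0..<T} \<times> UNIV) \<subseteq> S"
      using S by force
    from continuous_on_compose2[OF that D1' this] show ?thesis
      by (simp add: case_prod_unfold)
  qed
  have A: "continuous_on ({0..T} \<times> UNIV) (\<lambda>(t, x). \<phi> (u t x))"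
  proof -
    have "(\<lambda>(t, x). u t x) ` ({0..T} \<times> UNIV) \<subseteq> S"
      using S by force
    from continuous_on_compose2[OF c0 D(1) this] show ?thesis
      by (simp add: case_prod_unfold)
  qed
  have B: "((\<lambda>s. \<phi> (u s x)) has_real_derivative \<phi>' (u t x) * time_deriv T u t x)
      (at t within {0..T})" if "t \<in> {0..<T}" for t x
    using DERIV_chain2[OF d1 D(2)] S that by simp
  have P: "((\<lambda>x. \<phi> (u t x)) has_derivative (\<lambda>h. (\<phi>' (u t x) *\<^sub>R gradient (u t) x) \<bullet> h)) (at x)"
    if "t \<in> {0..<T}" for t x
  proof -
    have "(\<phi> has_derivative (\<lambda>h. \<phi>' (u t x) * h)) (at (u t x))"
      using d1 S that by (simp add: has_field_derivative_def)
    from has_derivative_compose[OF D(3)[OF that] this] show ?thesis by simp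
  qed
  have Q: "((\<lambda>x. \<phi>' (u t x) *\<^sub>R gradient (u t) x) has_derivative
      (\<lambda>h. (\<phi>' (u t x) *\<^sub>R hessian (u t) x
        + \<phi>'' (u t x) *\<^sub>R (\<chi> i j. gradient (u t) x $ i * gradient (u t) x $ j)) *v h)) (at x)"
    if "t \<in> {0..<T}" for t x
  proof -
    have "(\<phi>' has_derivative (\<lambda>h. \<phi>'' (u t x) * h)) (at (u t x))"
      using d2 S that by (simp add: has_field_derivative_def)
    \<comment> \<open>The product rule for \<phi>'(u) times the gradient gives a term sending h to a
      multiple of the gradient, with factor linear in h; \<open>outer_mult_vec\<close> recognizes it
      as a rank-one matrix.\<close>
    from has_derivative_scaleR[OF has_derivative_compose[OF D(3)[OF that] this] D(4)[OF that]]
    show ?thesis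
      by (simp add: matrix_vector_mult_add_rdistrib scaleR_matrix_vector_assoc[symmetric]
          outer_mult_vec)
  qed
  have E: "continuous_on ({0..<T} \<times> UNIV) (\<lambda>(t, x). \<phi>' (u t x) * time_deriv T u t x)"
    using continuous_on_mult[OF comp[OF c1] D(5)] by (simp add: case_prod_unfold)
  have F: "continuous_on ({0..<T} \<times> UNIV) (\<lambda>(t, x). \<phi>' (u t x) *\<^sub>R gradient (u t) x)"
    using continuous_on_scaleR[OF comp[OF c1] D(6)] by (simp add: case_prod_unfold)
  have G: "continuous_on ({0..<T} \<times> UNIV) (\<lambda>(t, x). \<phi>' (u t x) *\<^sub>R hessian (u t) x
        + \<phi>'' (u t x) *\<^sub>R (\<chi> i j. gradient (u t) x $ i * gradient (u t) x $ j))"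
    using comp[OF c1] comp[OF c2] D(6) D(7)
    by (auto simp: case_prod_unfold intro!: continuous_intros)
  note I = C12_I[OF \<open>T > 0\<close> A B P Q E F G]
  show "C12 T (\<lambda>t x. \<phi> (u t x))"
    by (rule I(1))
  show "\<And>t x. t \<in> {0..<T} \<Longrightarrow>
      time_deriv T (\<lambda>t x. \<phi> (u t x)) t x = \<phi>' (u t x) * time_deriv T u t x"
    by (rule I(2))
  show "\<And>t x. t \<in> {0..<T} \<Longrightarrow>
      gradient (\<lambda>x. \<phi> (u t x)) x = \<phi>' (u t x) *\<^sub>R gradient (u t) x"
    by (rule I(3))
  show "\<And>t x. t \<in> {0..<T} \<Longrightarrow>
      hessian (\<lambda>x. \<phi> (u t x)) x = \<phi>' (u t x) *\<^sub>R hessian (u t) x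
        + \<phi>'' (u t x) *\<^sub>R (\<chi> i j. gradient (u t) x $ i * gradient (u t) x $ j)"
    by (rule I(4))
qed

lemma sum_matrix_vector_mult:
  fixes M :: "'i \<Rightarrow> real^'n^'m"
  shows "(\<Sum>j\<in>A. M j) *v h = (\<Sum>j\<in>A. M j *v h)"
  by (induction A rule: infinite_finite_induct) (simp_all add: matrix_vector_mult_add_rdistrib)

text \<open>Used with coefficients from -\<alpha> to pass from the logarithms to \<open>J\<close>,
  and from the negated inverse matrix to pass back.\<close>

lemma C12_linear_combination:
  fixes u :: "'i \<Rightarrow> real \<Rightarrow> real^'n \<Rightarrow> real"
  assumes "T > 0" and u: "\<And>j. j \<in> A \<Longrightarrow> C12 T (u j)"
  shows "C12 T (\<lambda>t x. \<Sum>j\<in>A. c j * u j t x)"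
    and "\<And>t x. t \<in> {0..<T} \<Longrightarrow> time_deriv T (\<lambda>t x. \<Sum>j\<in>A. c j * u j t x) t x
      = (\<Sum>j\<in>A. c j * time_deriv T (u j) t x)"
    and "\<And>t x. t \<in> {0..<T} \<Longrightarrow> gradient (\<lambda>x. \<Sum>j\<in>A. c j * u j t x) x
      = (\<Sum>j\<in>A. c j *\<^sub>R gradient (u j t) x)"
    and "\<And>t x. t \<in> {0..<T} \<Longrightarrow> hessian (\<lambda>x. \<Sum>j\<in>A. c j * u j t x) x
      = (\<Sum>j\<in>A. c j *\<^sub>R hessian (u j t) x)"
proof -
  note D = C12_D[OF u]
  have A: "continuous_on ({0..T} \<times> UNIV) (\<lambda>(t, x). \<Sum>j\<in>A. c j * u j t x)"
    using D(1) by (auto simp: case_prod_unfold intro!: continuous_intros)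
  have B: "((\<lambda>s. \<Sum>j\<in>A. c j * u j s x) has_real_derivative
      (\<Sum>j\<in>A. c j * time_deriv T (u j) t x)) (at t within {0..T})" if "t \<in> {0..<T}" for t x
    using D(2) that by (intro DERIV_sum DERIV_cmult) auto
  have P: "((\<lambda>x. \<Sum>j\<in>A. c j * u j t x) has_derivative
      (\<lambda>h. (\<Sum>j\<in>A. c j *\<^sub>R gradient (u j t) x) \<bullet> h)) (at x)" if "t \<in> {0..<T}" for t x
    unfolding inner_sum_left inner_scaleR_left
    using D(3) that by (intro has_derivative_sum has_derivative_mult_right) auto
  have Q: "((\<lambda>x. \<Sum>j\<in>A. c j *\<^sub>R gradient (u j t) x) has_derivative
      (\<lambda>h. (\<Sum>j\<in>A. c j *\<^sub>R hessian (u j t) x) *v h)) (at x)" if "t \<in> {0..<T}" for t x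
    unfolding sum_matrix_vector_mult scaleR_matrix_vector_assoc[symmetric]
    using D(4) that by (intro has_derivative_sum has_derivative_scaleR_right) auto
  have E: "continuous_on ({0..<T} \<times> UNIV) (\<lambda>(t, x). \<Sum>j\<in>A. c j * time_deriv T (u j) t x)"
    using D(5) by (auto simp: case_prod_unfold intro!: continuous_intros)
  have F: "continuous_on ({0..<T} \<times> UNIV) (\<lambda>(t, x). \<Sum>j\<in>A. c j *\<^sub>R gradient (u j t) x)"
    using D(6) by (auto simp: case_prod_unfold intro!: continuous_intros)
  have G: "continuous_on ({0..<T} \<times> UNIV) (\<lambda>(t, x). \<Sum>j\<in>A. c j *\<^sub>R hessian (u j t) x)"
    using D(7) by (auto simp: case_prod_unfold intro!: continuous_intros)
  note I = C12_I[OF \<open>T > 0\<close> A B P Q E F G]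
  show "C12 T (\<lambda>t x. \<Sum>j\<in>A. c j * u j t x)"
    by (rule I(1))
  show "\<And>t x. t \<in> {0..<T} \<Longrightarrow> time_deriv T (\<lambda>t x. \<Sum>j\<in>A. c j * u j t x) t x
      = (\<Sum>j\<in>A. c j * time_deriv T (u j) t x)"
    by (rule I(2))
  show "\<And>t x. t \<in> {0..<T} \<Longrightarrow> gradient (\<lambda>x. \<Sum>j\<in>A. c j * u j t x) x
      = (\<Sum>j\<in>A. c j *\<^sub>R gradient (u j t) x)"
    by (rule I(3))
  show "\<And>t x. t \<in> {0..<T} \<Longrightarrow> hessian (\<lambda>x. \<Sum>j\<in>A. c j * u j t x) x
      = (\<Sum>j\<in>A. c j *\<^sub>R hessian (u j t) x)"
    by (rule I(4))
qed

section \<open>Linear algebra\<close>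

text \<open>Nonsingularity of \<alpha> enters only through this equivalence. It is stated for
  families of scalars because it is applied to logarithms, coordinates of gradients, terminal values
  and PDE residuals at a fixed point.\<close>

lemma matrix_inv_system_iff:
  fixes \<alpha> :: "real^'p^'p"
  assumes "invertible \<alpha>"
  shows "(\<forall>i. (\<Sum>j\<in>UNIV. \<alpha> $ i $ j * v j) = w i)
    \<longleftrightarrow> (\<forall>i. v i = (\<Sum>j\<in>UNIV. matrix_inv \<alpha> $ i $ j * w j))"
proof -
  have inv: "\<alpha> ** matrix_inv \<alpha> = mat 1" "matrix_inv \<alpha> ** \<alpha> = mat 1"
    using someI_ex[OF assms[unfolded invertible_def]] unfolding matrix_inv_def by simp_all
  have "\<alpha> *v vec_lambda v = vec_lambda w \<longleftrightarrow> vec_lambda v = matrix_inv \<alpha> *v vec_lambda w"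
    using inv by (metis matrix_vector_mul_assoc matrix_vector_mul_lid)
  then show ?thesis
    by (simp add: vec_eq_iff matrix_vector_mult_def)
qed

section \<open>Traces against linear combinations and rank-one matrices\<close>

lemma trace_mult_scaleR: "trace (G ** (c *\<^sub>R H)) = c * trace (G ** (H :: real^'n^'n))"
  by (simp add: trace_def matrix_matrix_mult_def sum_distrib_left ac_simps)

lemma trace_mult_linear_combination:
  fixes G :: "real^'n^'n"
  shows "trace (G ** (\<Sum>j\<in>A. c j *\<^sub>R H j)) = (\<Sum>j\<in>A. c j * trace (G ** H j))"
proof (induction A rule: infinite_finite_induct)
  case (insert a A)
  then show ?case
    by (simp add: matrix_add_ldistrib trace_add trace_mult_scaleR)
qed (simp_all add: trace_def)

lemma inner_transpose_mult:
  fixes A :: "real^'n^'m"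
  shows "y \<bullet> (transpose A *v w) = (A *v y) \<bullet> w"
  by (metis dot_lmul_matrix inner_commute transpose_matrix_vector)

text \<open>Against the matrix p p^T a trace becomes (G p) . p, and one factor of G = g g^T moves
  across the inner product. This evaluates the rank-one part of the Hessian of
  \<open>exp (L j)\<close>.\<close>

lemma trace_mult_outer:
  fixes g :: "real^'m^'n" and p :: "real^'n"
  shows "trace (g ** transpose g ** (\<chi> i j. p $ i * p $ j))
    = (transpose g *v p) \<bullet> (transpose g *v p)"
proof -
  have "trace (G ** (\<chi> i j. p $ i * p $ j)) = (G *v p) \<bullet> p" for G :: "real^'n^'n"
    by (simp add: trace_def matrix_matrix_mult_def matrix_vector_mult_def inner_vec_def
        sum_distrib_right mult.assoc)
  then have "trace (g ** transpose g ** (\<chi> i j. p $ i * p $ j))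
      = (g *v (transpose g *v p)) \<bullet> p"
    by (simp only: matrix_vector_mul_assoc)
  then show ?thesis
    by (simp only: inner_transpose_mult[symmetric])
qed

section \<open>Kronecker products and the quadratic form of the HJB equations\<close>

lemma transpose_kronecker: "transpose (A \<otimes>\<^sub>K B) = transpose A \<otimes>\<^sub>K transpose B"
  by (simp add: kronecker_def transpose_def vec_eq_iff)

text \<open>Exchanging the sum over blocks with the sum over positions lets \<open>B\<close> act
  once, on a combination of blocks weighted by a row of \<open>A\<close>.\<close>

lemma kronecker_mult_vec:
  "((A \<otimes>\<^sub>K B) *v (\<chi> r. q (fst r) $ snd r)) $ (a, c)
    = (B *v (\<Sum>b\<in>UNIV. A $ a $ b *\<^sub>R q b)) $ c"
proof -
  have "((A \<otimes>\<^sub>K B) *v (\<chi> r. q (fst r) $ snd r)) $ (a, c)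
      = (\<Sum>b\<in>UNIV. \<Sum>d\<in>UNIV. A $ a $ b * B $ c $ d * q b $ d)"
    by (simp add: kronecker_def matrix_vector_mult_def UNIV_Times_UNIV[symmetric]
        sum.cartesian_product' del: UNIV_Times_UNIV)
  also have "\<dots> = (\<Sum>d\<in>UNIV. \<Sum>b\<in>UNIV. A $ a $ b * B $ c $ d * q b $ d)"
    by (rule sum.swap)
  also have "\<dots> = (B *v (\<Sum>b\<in>UNIV. A $ a $ b *\<^sub>R q b)) $ c"
    by (simp add: matrix_vector_mult_def sum_distrib_left ac_simps)
  finally show ?thesis .
qed

lemma block_diag_scalar_mult_vec:
  "(block_diag (\<lambda>j. d j *\<^sub>R mat 1) *v y) $ (a, c) = d a * y $ (a, c)"
proof -
  have "(block_diag (\<lambda>j. d j *\<^sub>R mat 1) *v y) $ (a, c)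
      = (\<Sum>r\<in>UNIV. if r = (a, c) then d a * y $ r else 0)"
    unfolding block_diag_def matrix_vector_mult_def vec_lambda_beta
    by (intro sum.cong) (auto simp: mat_def)
  then show ?thesis by simp
qed

text \<open>The left Kronecker factor is the transpose of the right factor K, so the form is Q^T K^T
  D K Q. With D block-scalar this is a weighted sum of the squared norms of the blocks of K
  Q.\<close>

lemma hjb_quadratic_form:
  fixes \<beta> :: "real^'p^'p" and g :: "real^'m^'n" and q :: "'p \<Rightarrow> real^'n"
  defines "Q \<equiv> (\<chi> r. q (fst r) $ snd r)"
  shows "Q \<bullet> (((transpose \<beta> \<otimes>\<^sub>K g) ** block_diag (\<lambda>j. d j *\<^sub>R mat 1)
        ** (\<beta> \<otimes>\<^sub>K transpose g)) *v Q)
    = (\<Sum>j\<in>UNIV. d j * ((transpose g *v (\<Sum>k\<in>UNIV. \<beta> $ j $ k *\<^sub>R q k))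
        \<bullet> (transpose g *v (\<Sum>k\<in>UNIV. \<beta> $ j $ k *\<^sub>R q k))))"
proof -
  let ?K = "\<beta> \<otimes>\<^sub>K transpose g" and ?D = "block_diag (\<lambda>j. d j *\<^sub>R mat 1)"
  have K: "transpose \<beta> \<otimes>\<^sub>K g = transpose ?K"
    by (simp add: transpose_kronecker)
  have "Q \<bullet> (((transpose \<beta> \<otimes>\<^sub>K g) ** ?D ** ?K) *v Q) = (?K *v Q) \<bullet> (?D *v (?K *v Q))"
    unfolding K by (simp only: matrix_vector_mul_assoc[symmetric] inner_transpose_mult)
  also have "\<dots> = (\<Sum>a\<in>UNIV. \<Sum>c\<in>UNIV. (?K *v Q) $ (a, c) * (?D *v (?K *v Q)) $ (a, c))"
    by (simp add: inner_vec_def UNIV_Times_UNIV[symmetric] sum.cartesian_product'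
        del: UNIV_Times_UNIV)
  also have "\<dots> = (\<Sum>j\<in>UNIV. d j * ((transpose g *v (\<Sum>k\<in>UNIV. \<beta> $ j $ k *\<^sub>R q k))
        \<bullet> (transpose g *v (\<Sum>k\<in>UNIV. \<beta> $ j $ k *\<^sub>R q k))))"
    unfolding block_diag_scalar_mult_vec Q_def kronecker_mult_vec
    by (simp add: inner_vec_def sum_distrib_left ac_simps)
  finally show ?thesis .
qed

section \<open>The transformation\<close>

text \<open>The claim is pointwise in time and state. If all \<open>Z i t x\<close> are positive,
  taking logarithms leaves a linear system with matrix \<alpha>; otherwise both sides fail, since
  \<open>exp\<close> is positive.\<close>

lemma cole_hopf_iff_exp:
  fixes \<alpha> :: "real^'p^'p"
  assumes "invertible \<alpha>"
  shows "cole_hopf T \<alpha> J Z \<longleftrightarrow> cole_hopf_exp T \<alpha> J Z"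
proof -
  have "(\<forall>i. Z i t x > 0 \<and> J i t x = - (\<Sum>j\<in>UNIV. \<alpha> $ i $ j * ln (Z j t x)))
      \<longleftrightarrow> (\<forall>i. Z i t x = exp (- (\<Sum>j\<in>UNIV. matrix_inv \<alpha> $ i $ j * J j t x)))" for t x
  proof (cases "\<forall>i. Z i t x > 0")
    case True
    have "(\<forall>i. J i t x = - (\<Sum>j\<in>UNIV. \<alpha> $ i $ j * ln (Z j t x)))
        \<longleftrightarrow> (\<forall>i. (\<Sum>j\<in>UNIV. \<alpha> $ i $ j * ln (Z j t x)) = - J i t x)"
      by (intro iff_allI) auto
    also have "\<dots> \<longleftrightarrow> (\<forall>i. ln (Z i t x) = - (\<Sum>j\<in>UNIV. matrix_inv \<alpha> $ i $ j * J j t x))"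
      using matrix_inv_system_iff[OF assms, of "\<lambda>j. ln (Z j t x)" "\<lambda>i. - J i t x"]
      by (simp add: sum_negf)
    also have "\<dots> \<longleftrightarrow> (\<forall>i. Z i t x = exp (- (\<Sum>j\<in>UNIV. matrix_inv \<alpha> $ i $ j * J j t x)))"
    proof (rule iff_allI)
      fix i
      show "ln (Z i t x) = y \<longleftrightarrow> Z i t x = exp y" for y
        using True by (metis exp_ln ln_exp)
    qed
    finally show ?thesis using True by simp
  next
    case False
    then obtain i where "\<not> Z i t x > 0" by blast
    moreover from this have "Z i t x \<noteq> exp y" for y
      by (metis exp_gt_zero)
    ultimately show ?thesis by blast
  qed
  then show ?thesis
    unfolding cole_hopf_def cole_hopf_exp_def by meson
qed

text \<open>The comparison is made at one point (t, x) but for all players at once: a single HJB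
  equation is a combination of the linear equations with weights from a row of \<alpha>, so only the
  whole systems are matched.\<close>

lemma hjb_iff_linear:
  fixes f :: "real^'n \<Rightarrow> real^'n"
    and g :: "real^'n \<Rightarrow> real^'m^'n"
    and ubar :: "'p::finite \<Rightarrow> real \<Rightarrow> real^'n \<Rightarrow> real^'m"
    and J Z L :: "'p \<Rightarrow> real \<Rightarrow> real^'n \<Rightarrow> real"
    and \<alpha> :: "real^'p^'p"
  assumes "T > 0" and inv: "invertible \<alpha>"
    and u: "\<And>i j t x. \<alpha> $ i $ j \<noteq> 0 \<Longrightarrow> t \<in> {0..<T} \<Longrightarrow> g x *v ubar i t x = g x *v ubar j t x"
    and Z: "\<And>i t x. t \<in> {0..T} \<Longrightarrow> Z i t x = exp (L i t x)"
    and J: "\<And>i t x. t \<in> {0..T} \<Longrightarrow> J i t x = (\<Sum>j\<in>UNIV. (- \<alpha> $ i $ j) * L j t x)"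
    and L: "\<And>i. C12 T (L i)"
    and t: "t \<in> {0..<T}"
  shows "(\<forall>i. - time_deriv T (J i) t x =
            C i t x
          + (f x + g x *v ubar i t x) \<bullet> gradient (J i t) x
          + 1/2 * trace (g x ** transpose (g x) ** hessian (J i t) x)
          - 1/2 * (stacked_gradient J t x \<bullet>
              (((transpose (matrix_inv \<alpha>) \<otimes>\<^sub>K g x)
                ** block_diag (\<lambda>j. \<alpha> $ i $ j *\<^sub>R mat 1)
                ** (matrix_inv \<alpha> \<otimes>\<^sub>K transpose (g x))) *v stacked_gradient J t x)))
    \<longleftrightarrow> (\<forall>i. - time_deriv T (Z i) t x =
            (f x + g x *v ubar i t x) \<bullet> gradient (Z i t) x
          + 1/2 * trace (g x ** transpose (g x) ** hessian (Z i t) x)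
          - (\<Sum>j\<in>UNIV. matrix_inv \<alpha> $ i $ j * C j t x) * Z i t x)"
    (is "(\<forall>i. ?hjb i) \<longleftrightarrow> (\<forall>i. ?lin i)")
proof -
  let ?G = "g x ** transpose (g x)"
  define a where "a j = time_deriv T (L j) t x" for j
  define p where "p j = gradient (L j t) x" for j
  define H where "H j = hessian (L j t) x" for j
  define q where "q j = (transpose (g x) *v p j) \<bullet> (transpose (g x) *v p j)" for j
  define b where "b j = f x + g x *v ubar j t x" for j
  define E where "E j = a j + b j \<bullet> p j + 1/2 * trace (?G ** H j) + 1/2 * q j" for j
  have t': "t \<in> {0..T}" using t by auto
  have Zt: "time_deriv T (Z i) t x = Z i t x * a i"
    and Zg: "gradient (Z i t) x = Z i t x *\<^sub>R p i"
    and Zh: "hessian (Z i t) x = Z i t x *\<^sub>R (H i + (\<chi> k l. p i $ k * p i $ l))" for i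
  proof -
    \<comment> \<open>Both derivatives of \<open>exp\<close> are \<open>exp\<close> itself, so every
      derivative of \<open>Z i\<close> carries the factor \<open>Z i t x\<close>, which can later be
      cancelled.\<close>
    note K = C12_compose(2-4)[OF \<open>T > 0\<close> L[of i] UNIV_I DERIV_exp DERIV_exp
        continuous_on_exp[OF continuous_on_id] t, of x]
    show "time_deriv T (Z i) t x = Z i t x * a i"
      using K(1) time_deriv_cong[where u="Z i" and v="\<lambda>t x. exp (L i t x)", OF Z t']
      by (simp add: Z[OF t'] a_def)
    show "gradient (Z i t) x = Z i t x *\<^sub>R p i"
      using K(2) gradient_cong(1)[where u="Z i" and v="\<lambda>t x. exp (L i t x)", OF Z t']
      by (simp add: Z[OF t'] p_def)
    show "hessian (Z i t) x = Z i t x *\<^sub>R (H i + (\<chi> k l. p i $ k * p i $ l))"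
      using K(3) gradient_cong(2)[where u="Z i" and v="\<lambda>t x. exp (L i t x)", OF Z t']
      by (simp add: Z[OF t'] p_def H_def scaleR_add_right)
  qed
  have Jt: "time_deriv T (J i) t x = (\<Sum>j\<in>UNIV. (- \<alpha> $ i $ j) * a j)"
    and Jg: "gradient (J i t) x = (\<Sum>j\<in>UNIV. (- \<alpha> $ i $ j) *\<^sub>R p j)"
    and Jh: "hessian (J i t) x = (\<Sum>j\<in>UNIV. (- \<alpha> $ i $ j) *\<^sub>R H j)" for i
    using C12_linear_combination(2-4)[where u=L and A=UNIV and c="\<lambda>j. - \<alpha> $ i $ j",
        OF \<open>T > 0\<close> L t, of x]
      time_deriv_cong[where u="J i" and v="\<lambda>t x. \<Sum>j\<in>UNIV. (- \<alpha> $ i $ j) * L j t x", OF J t', of x]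
      gradient_cong[where u="J i" and v="\<lambda>t x. \<Sum>j\<in>UNIV. (- \<alpha> $ i $ j) * L j t x", OF J t']
    unfolding a_def p_def H_def by metis+
  have lin: "?lin i \<longleftrightarrow> E i = (\<Sum>j\<in>UNIV. matrix_inv \<alpha> $ i $ j * C j t x)" for i
  proof -
    have "Z i t x > 0" by (simp add: Z[OF t'])
    have "trace (?G ** hessian (Z i t) x) = Z i t x * (trace (?G ** H i) + q i)"
      unfolding Zh q_def
      by (simp add: trace_mult_scaleR matrix_add_ldistrib trace_add trace_mult_outer)
    then have "?lin i \<longleftrightarrow> Z i t x * (E i - (\<Sum>j\<in>UNIV. matrix_inv \<alpha> $ i $ j * C j t x)) = 0"
      unfolding Zt Zg E_def b_def[symmetric] by (auto simp: algebra_simps)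
    with \<open>Z i t x > 0\<close> show ?thesis by simp
  qed
  have grad_inv: "(\<Sum>k\<in>UNIV. matrix_inv \<alpha> $ j $ k *\<^sub>R gradient (J k t) x) = - p j" for j
  proof -
    \<comment> \<open>The system is inverted separately in each space coordinate
      \<open>c\<close>.\<close>
    have "(\<forall>k. (\<Sum>j\<in>UNIV. \<alpha> $ k $ j * (- p j $ c)) = gradient (J k t) x $ c)" for c
      by (simp add: Jg)
    then have "\<forall>j. - p j $ c = (\<Sum>k\<in>UNIV. matrix_inv \<alpha> $ j $ k * gradient (J k t) x $ c)" for c
      using matrix_inv_system_iff[OF inv, of "\<lambda>j. - p j $ c" "\<lambda>k. gradient (J k t) x $ c"]
      by blast
    then show ?thesis by (simp add: vec_eq_iff)
  qed
  have hjb: "?hjb i \<longleftrightarrow> (\<Sum>j\<in>UNIV. \<alpha> $ i $ j * E j) = C i t x" for i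
  proof -
    have quad: "stacked_gradient J t x \<bullet>
              (((transpose (matrix_inv \<alpha>) \<otimes>\<^sub>K g x)
                ** block_diag (\<lambda>j. \<alpha> $ i $ j *\<^sub>R mat 1)
                ** (matrix_inv \<alpha> \<otimes>\<^sub>K transpose (g x))) *v stacked_gradient J t x)
        = (\<Sum>j\<in>UNIV. \<alpha> $ i $ j * q j)"
      \<comment> \<open>By \<open>grad_inv\<close> the combinations in the quadratic form are the
        vectors \<open>- p j\<close>; the sign disappears because each occurs twice.\<close>
      unfolding stacked_gradient_def
        hjb_quadratic_form[where q="\<lambda>k. gradient (J k t) x"] grad_inv q_def
      by (simp only: linear_neg[OF matrix_vector_mul_linear] inner_minus_left inner_minus_right
          minus_minus)
    have drift: "b i \<bullet> gradient (J i t) x = - (\<Sum>j\<in>UNIV. \<alpha> $ i $ j * (b j \<bullet> p j))"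
    proof -
      \<comment> \<open>The compatibility of the nominal policies acts only here: the common drift
        \<open>b i\<close> of the HJB equation is exchanged for \<open>b j\<close> in each summand,
        and the summands with zero coefficient vanish anyway.\<close>
      have "\<alpha> $ i $ j * (b i \<bullet> p j) = \<alpha> $ i $ j * (b j \<bullet> p j)" for j
        using u[of i j t x] t by (cases "\<alpha> $ i $ j = 0") (simp_all add: b_def)
      then have "(\<Sum>j\<in>UNIV. \<alpha> $ i $ j * (b i \<bullet> p j)) = (\<Sum>j\<in>UNIV. \<alpha> $ i $ j * (b j \<bullet> p j))"
        by (intro sum.cong refl)
      then show ?thesis
        by (simp add: Jg inner_sum_right sum_negf)
    qed
    have tr: "trace (?G ** hessian (J i t) x) = - (\<Sum>j\<in>UNIV. \<alpha> $ i $ j * trace (?G ** H j))"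
      unfolding Jh trace_mult_linear_combination by (simp add: sum_negf)
    have "(\<Sum>j\<in>UNIV. \<alpha> $ i $ j * E j) = (\<Sum>j\<in>UNIV. \<alpha> $ i $ j * a j)
        + (\<Sum>j\<in>UNIV. \<alpha> $ i $ j * (b j \<bullet> p j)) + 1/2 * (\<Sum>j\<in>UNIV. \<alpha> $ i $ j * trace (?G ** H j))
        + 1/2 * (\<Sum>j\<in>UNIV. \<alpha> $ i $ j * q j)"
      unfolding E_def by (simp add: distrib_left sum.distrib sum_divide_distrib)
    then show ?thesis
      unfolding quad drift[unfolded b_def] tr Jt b_def by (auto simp: sum_negf)
  qed
  show ?thesis
    unfolding lin hjb by (rule matrix_inv_system_iff[OF inv])
qed

section \<open>From equations at a point to the solution predicates\<close>

theorem theorem2: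
  fixes T :: real
    and f :: "real^'n \<Rightarrow> real^'n"
    and g :: "real^'n \<Rightarrow> real^'m^'n"
    and ubar :: "'p::finite \<Rightarrow> real \<Rightarrow> real^'n \<Rightarrow> real^'m"
    and C :: "'p \<Rightarrow> real \<Rightarrow> real^'n \<Rightarrow> real"
    and \<Psi> :: "'p \<Rightarrow> real^'n \<Rightarrow> real"
    and \<alpha> :: "real^'p^'p"
    and J Z :: "'p \<Rightarrow> real \<Rightarrow> real^'n \<Rightarrow> real"
  assumes "T > 0"
    and "invertible \<alpha>"
    and "\<And>i. \<alpha> $ i $ i > 0"
    and "\<And>i j t x. \<alpha> $ i $ j \<noteq> 0 \<Longrightarrow> t \<in> {0..<T} \<Longrightarrow> g x *v ubar i t x = g x *v ubar j t x"
  shows "(cole_hopf T \<alpha> J Z \<longleftrightarrow> cole_hopf_exp T \<alpha> J Z) \<and>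
    (cole_hopf T \<alpha> J Z \<longrightarrow>
      (hjb_solution T f g ubar C \<Psi> \<alpha> J \<longleftrightarrow> linear_solution T f g ubar C \<Psi> \<alpha> Z))"
proof (intro conjI impI)
  note inv = \<open>invertible \<alpha>\<close>
  show "cole_hopf T \<alpha> J Z \<longleftrightarrow> cole_hopf_exp T \<alpha> J Z"
    by (rule cole_hopf_iff_exp[OF inv])
  assume ch: "cole_hopf T \<alpha> J Z"
  then have ch': "cole_hopf_exp T \<alpha> J Z"
    by (simp add: cole_hopf_iff_exp[OF inv])
  \<comment> \<open>Taken as a linear combination of the \<open>J j\<close> at all times, so that
    regularity passes directly from \<open>J\<close> to \<open>L\<close>; it equals the logarithm of
    \<open>Z i\<close> at times in \<open>{0..T}\<close>.\<close>
  define L where "L i t x = (\<Sum>j\<in>UNIV. (- matrix_inv \<alpha> $ i $ j) * J j t x)" for i t x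
  have Z: "Z i t x = exp (L i t x)" if "t \<in> {0..T}" for i t x
    using ch' that unfolding cole_hopf_exp_def L_def by (simp add: sum_negf)
  have lnZ: "L i t x = ln (Z i t x)" if "t \<in> {0..T}" for i t x
    using Z[OF that] by simp
  have J: "J i t x = (\<Sum>j\<in>UNIV. (- \<alpha> $ i $ j) * L j t x)" if "t \<in> {0..T}" for i t x
    using ch that unfolding cole_hopf_def by (simp add: lnZ sum_negf)
  \<comment> \<open>Each \<open>J i\<close> may involve every \<open>L j\<close> and conversely, so
    regularity is compared for whole families; for \<open>Z\<close> it is compared player by
    player.\<close>
  have CJ: "(\<forall>i. C12 T (J i)) \<longleftrightarrow> (\<forall>i. C12 T (L i))"
  proof
    assume "\<forall>i. C12 T (J i)"
    then show "\<forall>i. C12 T (L i)"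
      unfolding L_def[abs_def] by (intro allI C12_linear_combination(1) \<open>T > 0\<close>) simp
  next
    assume "\<forall>i. C12 T (L i)"
    then show "\<forall>i. C12 T (J i)"
      by (intro allI C12_cong[OF \<open>T > 0\<close> J] C12_linear_combination(1) \<open>T > 0\<close>) simp_all
  qed
  have CZ: "C12 T (Z i) \<longleftrightarrow> C12 T (L i)" for i
  proof
    assume Zi: "C12 T (Z i)"
    have "C12 T (\<lambda>t x. ln (Z i t x))"
    proof (rule C12_compose(1)[OF \<open>T > 0\<close> Zi, where S="{0<..}" and \<phi>'=inverse
          and \<phi>''="\<lambda>y. - (inverse y)\<^sup>2"])
      show "continuous_on {0<..} (\<lambda>y::real. - (inverse y)\<^sup>2)"
        by (intro continuous_intros) auto
      show "(inverse has_real_derivative - (inverse y)\<^sup>2) (at y)" if "y \<in> {0<..}" for y :: real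
        using that DERIV_inverse[of y UNIV] by (simp add: numeral_2_eq_2)
    qed (auto simp: Z DERIV_ln)
    with \<open>T > 0\<close> lnZ show "C12 T (L i)"
      by (rule C12_cong)
  next
    assume Li: "C12 T (L i)"
    have "C12 T (\<lambda>t x. exp (L i t x))"
      by (rule C12_compose(1)[OF \<open>T > 0\<close> Li, where S=UNIV and \<phi>'=exp and \<phi>''=exp])
        (auto intro!: continuous_intros)
    with \<open>T > 0\<close> Z show "C12 T (Z i)"
      by (rule C12_cong)
  qed
  have "T \<in> {0..T}" using \<open>T > 0\<close> by simp
  have terminal: "(\<forall>i. J i T x = \<Psi> i x)
      \<longleftrightarrow> (\<forall>i. Z i T x = exp (- (\<Sum>j\<in>UNIV. matrix_inv \<alpha> $ i $ j * \<Psi> j x)))" for x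
  proof -
    \<comment> \<open>At time T the relation between \<open>J\<close> and \<open>L\<close> is again
      a linear system, with unknowns \<open>- L j T x\<close>; injectivity of \<open>exp\<close>
      then turns its solution into values of \<open>Z\<close>.\<close>
    have "(\<forall>i. J i T x = \<Psi> i x) \<longleftrightarrow> (\<forall>i. (\<Sum>j\<in>UNIV. \<alpha> $ i $ j * (- L j T x)) = \<Psi> i x)"
      unfolding J[OF \<open>T \<in> {0..T}\<close>] by simp
    also have "\<dots> \<longleftrightarrow> (\<forall>i. - L i T x = (\<Sum>j\<in>UNIV. matrix_inv \<alpha> $ i $ j * \<Psi> j x))"
      by (rule matrix_inv_system_iff[OF inv])
    also have "\<dots> \<longleftrightarrow> (\<forall>i. L i T x = - (\<Sum>j\<in>UNIV. matrix_inv \<alpha> $ i $ j * \<Psi> j x))"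
      by (simp only: neg_equal_iff_equal[symmetric, of "L _ T x"] minus_minus)
    finally show ?thesis
      unfolding Z[OF \<open>T \<in> {0..T}\<close>] exp_inj_iff .
  qed
  show "hjb_solution T f g ubar C \<Psi> \<alpha> J \<longleftrightarrow> linear_solution T f g ubar C \<Psi> \<alpha> Z"
  \<comment> \<open>If some \<open>L i\<close> is irregular, then some member of each of the
    families \<open>J\<close> and \<open>Z\<close> is irregular too, so both predicates are false.
    Otherwise only equations and terminal data remain to be compared.\<close>
  proof (cases "\<forall>i. C12 T (L i)")
    case True
    have CJ': "\<And>i. C12 T (J i)" and CZ': "\<And>i. C12 T (Z i)"
      using True CJ CZ by blast+
    note eqs = hjb_iff_linear[OF \<open>T > 0\<close> inv assms(4) Z J]
    \<comment> \<open>The players are quantified outermost in the predicates, whereas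
      \<open>eqs\<close> and \<open>terminal\<close> compare whole systems at a point;
      \<open>True\<close> stands for the settled regularity clause.\<close>
    have swap: "(\<forall>i. True \<and> (\<forall>t\<in>{0..<T}. \<forall>x. P i t x) \<and> (\<forall>x. Q i x))
        \<longleftrightarrow> (\<forall>t\<in>{0..<T}. \<forall>x. \<forall>i. P i t x) \<and> (\<forall>x. \<forall>i. Q i x)"
      for P :: "'p \<Rightarrow> real \<Rightarrow> real^'n \<Rightarrow> bool" and Q :: "'p \<Rightarrow> real^'n \<Rightarrow> bool"
      by blast
    show ?thesis
      unfolding hjb_solution_def linear_solution_def eqTrueI[OF CJ'] eqTrueI[OF CZ'] swap terminal
      by (rule arg_cong2[where f=conj, OF ball_cong[OF refl iff_allI] refl], rule eqs)
        (use True in auto)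
  next
    case False
    then show ?thesis
      unfolding hjb_solution_def linear_solution_def using CJ CZ by blast
  qed
qed

end
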